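(* In the AON deletion model with deletion probability $q<1$, there exists a finite constant $C$ depending only on $q$ such that $\exp(C k\log_k n)$ independent traces suffice to reconstruct the binary labels of a complete $k$-ary tree on $n$ nodes with high probability (here $k \geq 2$); that is, there is an estimator which, given the topology, $q$ and that many traces, outputs the labels with probability tending to $1$ as $n\to\infty$.
   Context: A complete $k$-ary tree is a rooted tree in which every non-leaf node has exactly $k$ children, all leaves at the same depth; its non-root nodes carry unknown binary labels and children have a left-to-right order. AON (All-Or-Nothing) deletion model with parameter $q$: each non-root node is marked independently with probability $q$; a node is deleted if and only if it is marked or has a marked ancestor; the root is never deleted. The surviving labeled ordered tree is the trace. The goal is to recover the labels from independent traces, knowing the model, $q$ and the topology. *)

theory Defs
  imports "HOL-Probability.Product_PMF" "HOL-Library.Sublist"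
begin

text \<open>An ordered rooted tree in which every node except the root carries a label: each node is the
  left-to-right list of its children, and each child is paired with the label of its root.\<close>

datatype 'a ltree = LNode "('a \<times> 'a ltree) list"

lemma size_child [termination_simp]:
  fixes cs :: "('a \<times> 'a ltree) list"
  assumes "i < length cs"
  shows "size (snd (cs ! i)) < Suc (size_list (\<lambda>x. Suc (size (snd x))) cs)"
proof -
  have "Suc (size (snd (cs ! i))) \<le> size_list (\<lambda>x. Suc (size (snd x))) cs"
    using assms by (intro size_list_estimation'[of "cs ! i"]) auto
  then show ?thesis by simp
qed

definition shape :: "'a ltree \<Rightarrow> unit ltree" where
  "shape = map_ltree (\<lambda>_. ())"

text \<open>Nodes are addressed by the list of child indices on the path from the root \<open>[]\<close>.\<close>

fun nodes :: "'a ltree \<Rightarrow> nat list set" where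
  "nodes (LNode cs) = insert [] (\<Union>i\<in>{..<length cs}. (#) i ` nodes (snd (cs ! i)))"

definition children :: "'a ltree \<Rightarrow> nat list \<Rightarrow> nat list set" where
  "children t v = {w \<in> nodes t. \<exists>i. w = v @ [i]}"

definition leaves :: "'a ltree \<Rightarrow> nat list set" where
  "leaves t = {v \<in> nodes t. children t v = {}}"

definition complete_kary :: "nat \<Rightarrow> 'a ltree \<Rightarrow> bool" where
  "complete_kary k t \<longleftrightarrow>
     (\<forall>v \<in> nodes t - leaves t. card (children t v) = k) \<and>
     (\<exists>d. \<forall>v \<in> leaves t. length v = d)"

definition marking_pmf :: "real \<Rightarrow> 'a ltree \<Rightarrow> (nat list \<Rightarrow> bool) pmf" where
  "marking_pmf q t = Pi_pmf (nodes t - {[]}) False (\<lambda>_. bernoulli_pmf q)"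

text \<open>The prefixes of an address are the node itself and its ancestors.\<close>

definition deleted :: "(nat list \<Rightarrow> bool) \<Rightarrow> nat list \<Rightarrow> bool" where
  "deleted m v \<longleftrightarrow> (\<exists>u. prefix u v \<and> m u)"

text \<open>\<open>surviving D v t\<close> removes from \<open>t\<close>, seen as the subtree at address \<open>v\<close> of the original tree,
  every non-root node whose original address satisfies \<open>D\<close>.  As the deleted nodes are closed under
  taking descendants, removing a child together with its subtree removes deleted nodes only.
  The result does not record the original addresses.\<close>

fun surviving :: "(nat list \<Rightarrow> bool) \<Rightarrow> nat list \<Rightarrow> 'a ltree \<Rightarrow> 'a ltree" where
  "surviving D v (LNode cs) =
     LNode (map (\<lambda>i. (fst (cs ! i), surviving D (v @ [i]) (snd (cs ! i))))
                (filter (\<lambda>i. \<not> D (v @ [i])) [0..<length cs]))"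

definition trace_pmf :: "real \<Rightarrow> 'a ltree \<Rightarrow> 'a ltree pmf" where
  "trace_pmf q t = map_pmf (\<lambda>m. surviving (deleted m) [] t) (marking_pmf q t)"

end

theory Submission
  imports Defs
begin

text \<open>A node of a trace with as many children as in the original topology lost none of them, so
  their order identifies them. Hence a trace in which every node on the path to \<open>v\<close>
  keeps all its children determines the label of \<open>v\<close>; since the path has length at most
  \<open>log\<^sub>k n\<close>, this happens with probability at least \<open>(1 - q)\<close> to the power \<open>k * log\<^sub>k n\<close>. With
  \<open>n\<close> times the inverse of this many traces, a union bound shows that every label is
  determined by some trace, so that any labelling consistent with all traces is the correct one.\<close>

section \<open>Addresses and labels\<close>

lemma Nil_in_nodes [simp]: "[] \<in> nodes t"
  by (cases t) auto

lemma Cons_in_nodes_iff [simp]: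
  "i # v \<in> nodes (LNode cs) \<longleftrightarrow> i < length cs \<and> v \<in> nodes (snd (cs ! i))"
  by auto

lemma finite_nodes [simp]: "finite (nodes t)"
  by (induction t rule: nodes.induct) auto

lemma nodes_prefix_closed: "v \<in> nodes t \<Longrightarrow> prefix u v \<Longrightarrow> u \<in> nodes t"
proof (induction v arbitrary: t u)
  case Nil
  then show ?case by simp
next
  case (Cons i v)
  then show ?case by (cases t; cases u) auto
qed

fun label :: "'a ltree \<Rightarrow> nat list \<Rightarrow> 'a" where
  "label (LNode cs) [] = undefined"
| "label (LNode cs) [i] = fst (cs ! i)"
| "label (LNode cs) (i # j # v) = label (snd (cs ! i)) (j # v)"

lemma label_Cons: "v \<noteq> [] \<Longrightarrow> label (LNode cs) (i # v) = label (snd (cs ! i)) v"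
  by (cases v) auto

lemma shape_LNode: "shape (LNode cs) = LNode (map (\<lambda>(_, t). ((), shape t)) cs)"
  by (auto simp: shape_def)

lemma shape_LNode_eq_iff:
  "shape (LNode cs) = shape (LNode cs') \<longleftrightarrow>
     length cs = length cs' \<and> (\<forall>i<length cs. shape (snd (cs ! i)) = shape (snd (cs' ! i)))"
  by (auto simp: shape_LNode list_eq_iff_nth_eq case_prod_unfold)

text \<open>Reduces recovering a tree of known shape to recovering the label of each non-root node
  separately.\<close>

lemma ltree_eqI:
  assumes "shape t = shape t'"
    and "\<And>v. v \<in> nodes t \<Longrightarrow> v \<noteq> [] \<Longrightarrow> label t v = label t' v"
  shows "t = t'"
  using assms
proof (induction t arbitrary: t' rule: nodes.induct)
  case (1 cs)
  obtain cs' where t': "t' = LNode cs'" by (cases t')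
  have len: "length cs = length cs'"
    and sh: "\<And>i. i < length cs \<Longrightarrow> shape (snd (cs ! i)) = shape (snd (cs' ! i))"
    using 1(2) unfolding t' shape_LNode_eq_iff by auto
  have "cs ! i = cs' ! i" if i: "i < length cs" for i
  proof (rule prod_eqI)
    show "fst (cs ! i) = fst (cs' ! i)"
      using 1(3)[of "[i]"] i by (simp add: t' del: nodes.simps)
    show "snd (cs ! i) = snd (cs' ! i)"
    proof (rule 1(1))
      show "i \<in> {..<length cs}" using i by simp
      show "shape (snd (cs ! i)) = shape (snd (cs' ! i))" by (rule sh[OF i])
      fix v assume "v \<in> nodes (snd (cs ! i))" "v \<noteq> []"
      then show "label (snd (cs ! i)) v = label (snd (cs' ! i)) v"
        using 1(3)[of "i # v"] i by (simp add: t' label_Cons del: nodes.simps)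
    qed
  qed
  with len show ?case by (simp add: t' list_eq_iff_nth_eq)
qed

text \<open>These are the nodes whose joint survival makes a trace reveal the label at
  \<open>v\<close>. Prefixes are strict because siblings along the path, and \<open>v\<close>
  itself, matter, while the children of \<open>v\<close> do not.\<close>

definition path_children :: "'a ltree \<Rightarrow> nat list \<Rightarrow> nat list set" where
  "path_children t v = (\<Union>u\<in>{u. strict_prefix u v}. children t u)"

lemma path_children_iff:
  "w \<in> path_children t v \<longleftrightarrow> w \<in> nodes t \<and> (\<exists>u i. strict_prefix u v \<and> w = u @ [i])"
  by (auto simp: path_children_def children_def)

lemma path_children_Cons:
  "[j] \<in> path_children (LNode cs) (i # v) \<longleftrightarrow> j < length cs"
  "i < length cs \<Longrightarrow> w \<in> path_children (snd (cs ! i)) v \<Longrightarrow> i # w \<in> path_children (LNode cs) (i # v)"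
  by (auto simp: path_children_iff simp del: nodes.simps intro: exI[of _ "i # _"])

lemma finite_path_children [simp]: "finite (path_children t v)"
  by (rule finite_subset[of _ "nodes t"]) (auto simp: path_children_iff)

text \<open>Survival is assumed only for \<open>D\<close>; for \<open>D'\<close> it is forced. At
  each proper ancestor of \<open>v\<close> the trace of \<open>t\<close> shows all original
  children, so the equal trace of \<open>t'\<close>, which has equally many to start with, lost none
  either, and equal positions hold corresponding children. The address \<open>u\<close> is general
  so that the induction can descend.\<close>

lemma label_eq_if_surviving_eq:
  assumes "surviving D u t = surviving D' u t'" and "shape t = shape t'"
    and "v \<in> nodes t" and "v \<noteq> []" and "\<And>w. w \<in> path_children t v \<Longrightarrow> \<not> D (u @ w)"
  shows "label t v = label t' v"
  using assms
proof (induction v arbitrary: t t' u)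
  case Nil
  then show ?case by simp
next
  case (Cons i v)
  obtain cs where t: "t = LNode cs" by (cases t)
  obtain cs' where t': "t' = LNode cs'" by (cases t')
  have len: "length cs' = length cs"
    and sh: "\<And>i. i < length cs \<Longrightarrow> shape (snd (cs ! i)) = shape (snd (cs' ! i))"
    using Cons.prems(2) unfolding t t' shape_LNode_eq_iff by auto
  have i: "i < length cs" and v: "v \<in> nodes (snd (cs ! i))"
    using Cons.prems(3) unfolding t by auto
  let ?n = "length cs"
  have all: "filter (\<lambda>i. \<not> D (u @ [i])) [0..<?n] = [0..<?n]"
    using Cons.prems(5) unfolding t by (auto simp: path_children_Cons intro!: filter_True)
  have eq: "map (\<lambda>i. (fst (cs ! i), surviving D (u @ [i]) (snd (cs ! i)))) [0..<?n]
      = map (\<lambda>i. (fst (cs' ! i), surviving D' (u @ [i]) (snd (cs' ! i))))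
          (filter (\<lambda>i. \<not> D' (u @ [i])) [0..<?n])"
    using Cons.prems(1) unfolding t t' by (simp add: all len)
  \<comment> \<open>Equality of the two child lists forces the filter for \<open>D'\<close> to keep
    the full number of indices, hence every index.\<close>
  have "length (filter (\<lambda>i. \<not> D' (u @ [i])) [0..<?n]) = length [0..<?n]"
    using arg_cong[OF eq, of length] by simp
  then have all': "filter (\<lambda>i. \<not> D' (u @ [i])) [0..<?n] = [0..<?n]"
    by (metis filter_True length_filter_less less_irrefl)
  have fst_eq: "fst (cs ! i) = fst (cs' ! i)"
    and snd_eq: "surviving D (u @ [i]) (snd (cs ! i)) = surviving D' (u @ [i]) (snd (cs' ! i))"
    using eq i unfolding all' by auto
  show ?case
  proof (cases "v = []")
    case True
    then show ?thesis using fst_eq by (simp add: t t')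
  next
    case False
    have "label (snd (cs ! i)) v = label (snd (cs' ! i)) v"
    proof (rule Cons.IH[OF snd_eq sh[OF i] v False])
      fix w assume "w \<in> path_children (snd (cs ! i)) v"
      then have "i # w \<in> path_children t (i # v)"
        using i by (simp add: t path_children_Cons)
      then show "\<not> D ((u @ [i]) @ w)"
        using Cons.prems(5) by fastforce
    qed
    then show ?thesis using False by (simp add: t t' label_Cons)
  qed
qed

section \<open>Complete trees\<close>

lemma children_subset: "children t v \<subseteq> nodes t"
  by (auto simp: children_def)

lemma finite_children [simp]: "finite (children t v)"
  by (rule finite_subset[OF children_subset]) simp

text \<open>The path has \<open>length v\<close> proper prefixes. Each has the next path node as a
  child, so it is not a leaf and has exactly \<open>k\<close> children.\<close>

lemma card_path_children_le:
  assumes "complete_kary k t" and "v \<in> nodes t"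
  shows "card (path_children t v) \<le> length v * k"
proof -
  have strict: "{u. strict_prefix u v} = (\<lambda>j. take j v) ` {..<length v}"
  proof (intro equalityI subsetI)
    fix u assume "u \<in> {u. strict_prefix u v}"
    then have "u = take (length u) v" "length u < length v"
      by (auto simp: strict_prefix_def prefix_def)
    then show "u \<in> (\<lambda>j. take j v) ` {..<length v}" by blast
  qed (auto simp: strict_prefix_def take_is_prefix)
  have "card (children t (take j v)) \<le> k" if "j < length v" for j
  proof -
    have "take j v @ [v ! j] \<in> nodes t"
      using nodes_prefix_closed[OF assms(2) take_is_prefix[of "Suc j"]] that
      by (simp add: take_Suc_conv_app_nth)
    then have "children t (take j v) \<noteq> {}"
      by (auto simp: children_def)
    moreover have "take j v \<in> nodes t"
      using nodes_prefix_closed[OF assms(2)] by (simp add: take_is_prefix)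
    ultimately show ?thesis
      using assms(1) by (simp add: complete_kary_def leaves_def)
  qed
  then have "(\<Sum>j<length v. card (children t (take j v))) \<le> length v * k"
    using sum_bounded_above[of "{..<length v}" "\<lambda>j. card (children t (take j v))" k] by simp
  moreover have "card (path_children t v) \<le> (\<Sum>j<length v. card (children t (take j v)))"
    unfolding path_children_def strict UN_simps(10) image_image
    by (intro card_UN_le) simp
  ultimately show ?thesis by linarith
qed

text \<open>Every level down to the common leaf depth \<open>d\<close> is full, so the level of
  \<open>v\<close> alone already has \<open>k ^ length v\<close> nodes.\<close>

lemma pow_length_le_card_nodes:
  assumes "complete_kary k t" and "v \<in> nodes t"
  shows "k ^ length v \<le> card (nodes t)"
proof -
  obtain d where d: "\<And>u. u \<in> leaves t \<Longrightarrow> length u = d"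
    using assms(1) by (auto simp: complete_kary_def)
  define lev where "lev j = {u \<in> nodes t. length u = j}" for j
  have fin: "finite (lev j)" for j by (simp add: lev_def)
  \<comment> \<open>A deepest descendant of \<open>v\<close> is a leaf, hence at depth
    \<open>d\<close>; this places \<open>v\<close> at depth at most \<open>d\<close>.\<close>
  let ?S = "{u \<in> nodes t. prefix v u}"
  have fin_S: "finite (length ` ?S)" and "length ` ?S \<noteq> {}"
    using assms(2) by auto
  then have "Max (length ` ?S) \<in> length ` ?S"
    by (rule Max_in)
  then obtain u where u: "u \<in> ?S" and len_u: "Max (length ` ?S) = length u"
    by (rule imageE)
  have max: "length w \<le> length u" if "w \<in> ?S" for w
    unfolding len_u[symmetric] using fin_S that by (intro Max_ge imageI)
  have "u \<in> leaves t"
    using u max by (fastforce simp: leaves_def children_def)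
  then have le: "length v \<le> d"
    using u d prefix_length_le by fastforce
  have "card (lev j) = k ^ j" if "j \<le> d" for j
    using that
  proof (induction j)
    case 0
    have "lev 0 = {[]}" by (auto simp: lev_def)
    then show ?case by simp
  next
    case (Suc j)
    have eq: "lev (Suc j) = (\<Union>u\<in>lev j. children t u)"
    proof (intro equalityI subsetI)
      fix w assume w: "w \<in> lev (Suc j)"
      then obtain u i where "w = u @ [i]"
        by (cases w rule: rev_cases) (auto simp: lev_def)
      with w show "w \<in> (\<Union>u\<in>lev j. children t u)"
        using nodes_prefix_closed[of w t u] by (auto simp: lev_def children_def)
    qed (auto simp: lev_def children_def)
    have "card (children t u) = k" if "u \<in> lev j" for u
    proof -
      have "u \<notin> leaves t" using d[of u] that Suc.prems by (auto simp: lev_def)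
      then show ?thesis using assms(1) that by (auto simp: complete_kary_def lev_def)
    qed
    moreover have "card (\<Union>u\<in>lev j. children t u) = (\<Sum>u\<in>lev j. card (children t u))"
      by (intro card_UN_disjoint) (use fin in \<open>auto simp: children_def\<close>)
    ultimately show ?case using Suc by (simp add: eq)
  qed
  then have "k ^ length v = card (lev (length v))" using le by simp
  also have "\<dots> \<le> card (nodes t)" by (intro card_mono) (auto simp: lev_def)
  finally show ?thesis .
qed

section \<open>Informative traces\<close>

text \<open>Being in the support means that \<open>t'\<close> can produce \<open>s\<close> under
  some possible marking. So these are the traces on whose label at \<open>v\<close> all trees that
  could explain them agree with \<open>t\<close>.\<close>

definition determines_label :: "real \<Rightarrow> 'a ltree \<Rightarrow> nat list \<Rightarrow> 'a ltree set" where
  "determines_label q t v =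
     {s. \<forall>t'. shape t' = shape t \<longrightarrow> s \<in> set_pmf (trace_pmf q t') \<longrightarrow> label t v = label t' v}"

text \<open>The bound is the exact probability that all of \<open>path_children t v\<close> is
  unmarked. This already rules out deletion there: every nonempty prefix of such a node is again in
  \<open>path_children t v\<close>.\<close>

lemma prob_determines_label_ge:
  assumes q: "0 \<le> q" "q < 1" and v: "v \<in> nodes t" "v \<noteq> []"
  shows "measure_pmf.prob (trace_pmf q t) (determines_label q t v)
           \<ge> (1 - q) ^ card (path_children t v)"
proof -
  let ?A = "path_children t v" and ?N = "nodes t - {[]}"
  \<comment> \<open>Nodes off the path are unconstrained and contribute a factor 1 to the
    product.\<close>
  define B where "B w = (if w \<in> ?A then {False} else UNIV)" for w
  have sub: "?A \<subseteq> ?N" by (auto simp: path_children_iff)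
  have B: "measure_pmf.prob (bernoulli_pmf q) (B w) = (if w \<in> ?A then 1 - q else 1)" for w
    using q by (simp add: B_def measure_pmf_single)
  have "measure_pmf.prob (marking_pmf q t) (Pi ?N B)
      = (\<Prod>w\<in>?N. measure_pmf.prob (bernoulli_pmf q) (B w))"
    unfolding marking_pmf_def by (rule measure_Pi_pmf_Pi) simp
  also have "\<dots> = (1 - q) ^ card ?A"
    using sub by (simp add: B prod.If_cases Int_absorb1)
  finally have "(1 - q) ^ card ?A = measure_pmf.prob (marking_pmf q t) (Pi ?N B)" ..
  \<comment> \<open>On the support, the root takes the default value \<open>False\<close>. This is
    needed because \<open>deleted\<close> inspects all prefixes, including the empty one.\<close>
  also have "\<dots> = measure_pmf.prob (marking_pmf q t) (Pi ?N B \<inter> set_pmf (marking_pmf q t))"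
    by (rule measure_Int_set_pmf[symmetric])
  also have "\<dots> \<le> measure_pmf.prob (marking_pmf q t)
      ((\<lambda>m. surviving (deleted m) [] t) -` determines_label q t v)"
  proof (intro measure_pmf.finite_measure_mono)
    show "Pi ?N B \<inter> set_pmf (marking_pmf q t)
        \<subseteq> (\<lambda>m. surviving (deleted m) [] t) -` determines_label q t v"
    proof
      fix m assume m: "m \<in> Pi ?N B \<inter> set_pmf (marking_pmf q t)"
      have root: "\<not> m []"
        using m set_Pi_pmf_subset[of ?N False "\<lambda>_. bernoulli_pmf q"]
        by (auto simp: marking_pmf_def)
      have unmarked: "\<not> m w" if "w \<in> ?A" for w
        using PiE[of m ?N B w] m that sub by (auto simp: B_def)
      have "\<not> deleted m w" if w: "w \<in> ?A" for w
      proof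
        assume "deleted m w"
        then obtain u where u: "prefix u w" "m u" by (auto simp: deleted_def)
        then have "u \<noteq> []" using root by auto
        then obtain u' i where u': "u = u' @ [i]" by (cases u rule: rev_cases) auto
        obtain w' j where w': "strict_prefix w' v" "w = w' @ [j]" "w \<in> nodes t"
          using w by (auto simp: path_children_iff)
        have "prefix u' w'" using u(1) w'(2) u' by (auto simp: prefix_snoc dest: append_prefixD)
        then have "u \<in> ?A"
          using w' u' nodes_prefix_closed[OF w'(3) u(1)]
          by (auto simp: path_children_iff intro: prefix_order.le_less_trans)
        with unmarked u(2) show False by auto
      qed
      then have determined: "label t v = label t' v"
        if "shape t' = shape t" "surviving (deleted m) [] t = surviving (deleted m') [] t'" for t' m'
        using label_eq_if_surviving_eq[OF that(2) that(1)[symmetric] v] by simp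
      show "m \<in> (\<lambda>m. surviving (deleted m) [] t) -` determines_label q t v"
        unfolding determines_label_def vimage_def mem_Collect_eq trace_pmf_def set_map_pmf
        using determined by blast
    qed
  qed simp
  finally show ?thesis by (simp add: trace_pmf_def)
qed

text \<open>The sets may be uncountable, so both are cut down to the countable supports before the
  product rule is applied.\<close>

lemma prob_pair_pmf_Times:
  "measure_pmf.prob (pair_pmf p r) (A \<times> B) = measure_pmf.prob p A * measure_pmf.prob r B"
proof -
  have "measure_pmf.prob (pair_pmf p r) (A \<times> B)
      = measure_pmf.prob (pair_pmf p r) (A \<times> B \<inter> set_pmf (pair_pmf p r))"
    by (rule measure_Int_set_pmf[symmetric])
  also have "A \<times> B \<inter> set_pmf (pair_pmf p r) = (A \<inter> set_pmf p) \<times> (B \<inter> set_pmf r)"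
    by auto
  also have "measure_pmf.prob (pair_pmf p r) \<dots>
      = measure_pmf.prob p (A \<inter> set_pmf p) * measure_pmf.prob r (B \<inter> set_pmf r)"
    by (rule measure_pmf_prob_product) (auto intro: countable_subset[OF Int_lower2])
  finally show ?thesis by (simp only: measure_Int_set_pmf)
qed

lemma prob_replicate_pmf_disjoint:
  "measure_pmf.prob (replicate_pmf n p) {xs. set xs \<inter> E = {}} = (1 - measure_pmf.prob p E) ^ n"
proof (induction n)
  case 0
  show ?case by (simp add: measure_return)
next
  case (Suc n)
  let ?F = "{xs. set xs \<inter> E = {}}"
  have eq: "(\<lambda>(x, xs). x # xs) -` ?F = (- E) \<times> ?F" by auto
  have "replicate_pmf (Suc n) p = map_pmf (\<lambda>(x, xs). x # xs) (pair_pmf p (replicate_pmf n p))"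
    by (simp add: pair_pmf_def map_bind_pmf)
  then have "measure_pmf.prob (replicate_pmf (Suc n) p) ?F
      = measure_pmf.prob (pair_pmf p (replicate_pmf n p)) ((- E) \<times> ?F)"
    by (simp only: measure_map_pmf eq)
  also have "\<dots> = measure_pmf.prob p (- E) * measure_pmf.prob (replicate_pmf n p) ?F"
    by (rule prob_pair_pmf_Times)
  finally show ?case
    using Suc measure_pmf.prob_compl[of E p] by (simp add: Compl_eq_Diff_UNIV)
qed

section \<open>The estimator\<close>

text \<open>No likelihoods are compared: any labelling that makes every observed trace possible is
  accepted. The choice matters only when several labellings, or none, qualify.\<close>

definition consistent_tree :: "unit ltree \<Rightarrow> real \<Rightarrow> 'a ltree list \<Rightarrow> 'a ltree" where
  "consistent_tree s q xs = (SOME t. shape t = s \<and> set xs \<subseteq> set_pmf (trace_pmf q t))"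

lemma consistent_tree_eqI:
  assumes "set xs \<subseteq> set_pmf (trace_pmf q t)"
    and "\<And>v. v \<in> nodes t \<Longrightarrow> v \<noteq> [] \<Longrightarrow> set xs \<inter> determines_label q t v \<noteq> {}"
  shows "consistent_tree (shape t) q xs = t"
  unfolding consistent_tree_def
proof (rule some_equality)
  fix t' assume t': "shape t' = shape t \<and> set xs \<subseteq> set_pmf (trace_pmf q t')"
  show "t' = t"
  proof (rule ltree_eqI[symmetric])
    fix v assume "v \<in> nodes t" "v \<noteq> []"
    then obtain s where "s \<in> set xs" "s \<in> determines_label q t v"
      using assms(2) by blast
    then show "label t v = label t' v"
      using t' by (auto simp: determines_label_def)
  qed (use t' in simp)
qed (use assms in simp)

text \<open>A union bound over the non-root nodes: the estimator can fail only if some node has its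
  label determined by none of the \<open>T\<close> independent traces.\<close>

lemma prob_consistent_tree_ge:
  assumes q: "0 \<le> q" "q < 1"
    and p: "\<And>v. v \<in> nodes t \<Longrightarrow> p \<le> (1 - q) ^ card (path_children t v)"
  shows "measure_pmf.prob (replicate_pmf T (trace_pmf q t))
           {xs. consistent_tree (shape t) q xs = t} \<ge> 1 - card (nodes t) * exp (- p * T)"
proof -
  let ?M = "replicate_pmf T (trace_pmf q t)"
  let ?G = "{xs. consistent_tree (shape t) q xs = t}" and ?N = "nodes t - {[]}"
  define F where "F v = {xs. set xs \<inter> determines_label q t v = {}}" for v
  have F: "measure_pmf.prob ?M (F v) \<le> exp (- p * T)" if v: "v \<in> ?N" for v
  proof -
    let ?r = "measure_pmf.prob (trace_pmf q t) (determines_label q t v)"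
    have "p \<le> ?r"
      using p[of v] prob_determines_label_ge[OF q, of v t] v by simp
    \<comment> \<open>Combines \<open>1 - ?r \<le> 1 - p\<close> with
      \<open>1 - p \<le> exp (- p)\<close>.\<close>
    then have "1 - ?r \<le> exp (- p)"
      using exp_ge_add_one_self[of "- p"] by linarith
    then have "(1 - ?r) ^ T \<le> exp (- p) ^ T"
      by (intro power_mono) (auto intro: measure_pmf.prob_le_1)
    then show ?thesis
      by (simp add: F_def prob_replicate_pmf_disjoint exp_of_nat_mult[symmetric] mult.commute)
  qed
  \<comment> \<open>Within the support the true tree is itself consistent with all traces, so
    failure means non-uniqueness and hence an undetermined label.\<close>
  have "measure_pmf.prob ?M (- ?G) = measure_pmf.prob ?M (- ?G \<inter> set_pmf ?M)"
    by (rule measure_Int_set_pmf[symmetric])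
  also have "\<dots> \<le> measure_pmf.prob ?M (\<Union>v\<in>?N. F v)"
  proof (intro measure_pmf.finite_measure_mono subsetI)
    fix xs assume xs: "xs \<in> - ?G \<inter> set_pmf ?M"
    then have "set xs \<subseteq> set_pmf (trace_pmf q t)"
      by (auto simp: set_replicate_pmf)
    then show "xs \<in> (\<Union>v\<in>?N. F v)"
      using consistent_tree_eqI[of xs q t] xs by (auto simp: F_def)
  qed simp
  also have "\<dots> \<le> (\<Sum>v\<in>?N. measure_pmf.prob ?M (F v))"
    by (intro measure_pmf.finite_measure_subadditive_finite) auto
  also have "\<dots> \<le> (\<Sum>v\<in>?N. exp (- p * T))"
    by (intro sum_mono F)
  also have "\<dots> \<le> card (nodes t) * exp (- p * T)"
    by (simp add: mult_right_mono card_Diff1_le)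
  finally have "measure_pmf.prob ?M (- ?G) \<le> card (nodes t) * exp (- p * T)" .
  then show ?thesis
    using measure_pmf.prob_compl[of ?G ?M] by (simp add: Compl_eq_Diff_UNIV)
qed

lemma prob_consistent_tree_complete_kary:
  fixes t :: "'a ltree" and k :: nat
  defines "n \<equiv> card (nodes t)"
  assumes q: "0 \<le> q" "q < 1" and k: "k \<ge> 2" and t: "complete_kary k t"
  shows "measure_pmf.prob
           (replicate_pmf (nat \<lceil>exp ((1 - ln (1 - q)) * real k * log (real k) (real n))\<rceil>) (trace_pmf q t))
           {xs. consistent_tree (shape t) q xs = t} \<ge> 1 - n * exp (- n)"
proof -
  define L where "L = log (real k) (real n)"
  \<comment> \<open>This is \<open>1 - q\<close> to the real power \<open>k * L\<close>, a lower
    bound valid for all nodes at once. In the exponent of \<open>T\<close>, the term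
    \<open>- ln (1 - q)\<close> cancels \<open>p\<close> and the term 1 leaves
    \<open>exp (k * L)\<close>, which is at least \<open>n\<close>.\<close>
  define p where "p = exp (ln (1 - q) * (k * L))"
  define T where "T = nat \<lceil>exp ((1 - ln (1 - q)) * real k * L)\<rceil>"
  have "n > 0" unfolding n_def by (subst card_gt_0_iff) (auto intro: Nil_in_nodes)
  have p_le: "p \<le> (1 - q) ^ card (path_children t v)" if v: "v \<in> nodes t" for v
  proof -
    have "length v \<le> L"
      using pow_length_le_card_nodes[OF t v] k \<open>n > 0\<close>
      by (simp add: L_def n_def le_log_iff powr_realpow flip: of_nat_power)
    then have "real (length v * k) \<le> k * L"
      by (simp add: mult.commute[of _ "real k"] mult_left_mono)
    then have "real (card (path_children t v)) \<le> k * L"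
      using card_path_children_le[OF t v] by linarith
    \<comment> \<open>Since \<open>ln (1 - q)\<close> is at most 0, enlarging the exponent from the
      actual number of path children to \<open>k * L\<close> only decreases the value.\<close>
    then have "p \<le> exp (ln (1 - q) * card (path_children t v))"
      using q by (simp add: p_def mult_left_mono_neg)
    also have "\<dots> = (1 - q) ^ card (path_children t v)"
      using q by (simp add: exp_of_nat2_mult)
    finally show ?thesis .
  qed
  \<comment> \<open>From \<open>ln k \<le> k - 1\<close>; dividing by the positive
    \<open>ln k\<close> turns this into \<open>ln n \<le> k * L\<close>.\<close>
  have "ln n * ln k \<le> ln n * k"
    using \<open>n > 0\<close> k ln_le_minus_one[of "real k"] by (intro mult_left_mono) auto
  then have "ln n \<le> k * L"
    using k by (simp add: L_def log_def field_simps)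
  then have "real n \<le> exp (k * L)"
    using \<open>n > 0\<close> exp_le_cancel_iff[of "ln (real n)"] by simp
  also have "\<dots> = p * exp ((1 - ln (1 - q)) * real k * L)"
    by (simp add: p_def algebra_simps flip: exp_add)
  also have "\<dots> \<le> p * T"
    unfolding T_def by (intro mult_left_mono real_nat_ceiling_ge) (simp add: p_def)
  finally have "exp (- p * T) \<le> exp (- real n)" by simp
  then have "n * exp (- p * T) \<le> n * exp (- real n)"
    by (intro mult_left_mono) auto
  then show ?thesis
    using prob_consistent_tree_ge[OF q p_le, of T] unfolding n_def T_def L_def by linarith
qed

theorem theorem5:
  shows "\<exists>est :: unit ltree \<Rightarrow> real \<Rightarrow> bool ltree list \<Rightarrow> bool ltree.
    \<forall>q::real. 0 \<le> q \<and> q < 1 \<longrightarrow>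
      (\<exists>C::real. \<forall>\<epsilon>::real. \<epsilon> > 0 \<longrightarrow>
        (\<exists>N::nat. \<forall>(k::nat) (n::nat) (X :: bool ltree).
           k \<ge> 2 \<and> n \<ge> N \<and> complete_kary k X \<and> card (nodes X) = n \<longrightarrow>
           measure_pmf.prob
             (replicate_pmf (nat \<lceil>exp (C * real k * log (real k) (real n))\<rceil>) (trace_pmf q X))
             {traces. est (shape X) q traces = X} \<ge> 1 - \<epsilon>))"
\<comment> \<open>The estimator is fixed before \<open>q\<close>, \<open>k\<close> and
  \<open>X\<close>; it learns \<open>q\<close> and the topology from its arguments.\<close>
proof (rule exI[of _ consistent_tree], intro allI impI, elim conjE)
  fix q :: real
  assume q: "0 \<le> q" "q < 1"
  show "\<exists>C::real. \<forall>\<epsilon>::real. \<epsilon> > 0 \<longrightarrow>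
        (\<exists>N::nat. \<forall>(k::nat) (n::nat) (X :: bool ltree).
           k \<ge> 2 \<and> n \<ge> N \<and> complete_kary k X \<and> card (nodes X) = n \<longrightarrow>
           measure_pmf.prob
             (replicate_pmf (nat \<lceil>exp (C * real k * log (real k) (real n))\<rceil>) (trace_pmf q X))
             {traces. consistent_tree (shape X) q traces = X} \<ge> 1 - \<epsilon>)"
  proof (rule exI[of _ "1 - ln (1 - q)"], intro allI impI)
    fix \<epsilon> :: real
    assume "\<epsilon> > 0"
    \<comment> \<open>The failure bound \<open>n * exp (- n)\<close> involves neither
      \<open>k\<close> nor \<open>X\<close>, so a single \<open>N\<close> serves all complete trees.
      The power 1 matches the form of the limit rule.\<close>
    have "(\<lambda>n. real n ^ 1 / exp (real n)) \<longlonglongrightarrow> 0"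
      by (rule filterlim_compose[OF tendsto_power_div_exp_0 filterlim_real_sequentially])
    then have "\<forall>\<^sub>F n in sequentially. real n ^ 1 / exp (real n) < \<epsilon>"
      using \<open>\<epsilon> > 0\<close> by (rule order_tendstoD)
    then obtain N where N: "\<And>n. n \<ge> N \<Longrightarrow> real n * exp (- real n) < \<epsilon>"
      by (auto simp: eventually_sequentially exp_minus divide_inverse)
    show "\<exists>N::nat. \<forall>(k::nat) (n::nat) (X :: bool ltree).
           k \<ge> 2 \<and> n \<ge> N \<and> complete_kary k X \<and> card (nodes X) = n \<longrightarrow>
           measure_pmf.prob
             (replicate_pmf (nat \<lceil>exp ((1 - ln (1 - q)) * real k * log (real k) (real n))\<rceil>)
               (trace_pmf q X))
             {traces. consistent_tree (shape X) q traces = X} \<ge> 1 - \<epsilon>"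
    proof (rule exI[of _ N], intro allI impI, elim conjE)
      fix k n :: nat and X :: "bool ltree"
      assume "k \<ge> 2" "n \<ge> N" "complete_kary k X" "card (nodes X) = n"
      then show "measure_pmf.prob
             (replicate_pmf (nat \<lceil>exp ((1 - ln (1 - q)) * real k * log (real k) (real n))\<rceil>)
               (trace_pmf q X))
             {traces. consistent_tree (shape X) q traces = X} \<ge> 1 - \<epsilon>"
        using prob_consistent_tree_complete_kary[OF q, of k X] N[of n] by simp
    qed
  qed
qed

end
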